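(* Let $\alpha=(a_1,\dots,a_n)$ be a zero-sum-free sequence of elements of an abelian group. If $|\Sigma(\alpha)|<2n$ then, after suitably renumbering the elements of $\alpha$, there are a group element $a$ and integers $1=x_1\le x_2\le\dots\le x_n$ satisfying $x_{k+1}\le x_1+\dots+x_k$ for all $k\in[1,n-1]$, such that $a_k=x_k a$ for all $k\in[1,n]$. Moreover, $\Sigma(\alpha)=\{0,a,2a,\dots,(x_1+\dots+x_n)a\}$, and if $a$ is of finite order, then $x_1+\dots+x_n<\operatorname{ord}(a)$.
   Context: A (finite) sequence $\alpha=(a_1,\dots,a_n)$ of elements of an abelian group (written additively, terms may repeat) is zero-sum-free if no nonempty subsequence has sum of its terms equal to $0$. The set of all subsequence sums, including the empty subsequence with sum $0$, is $\Sigma(\alpha)=\{\sum_{i\in I}a_i : I\subseteq[1,n]\}$. Here $[u,v]$ denotes the set of integers $k$ with $u\le k\le v$, and $\operatorname{ord}(a)$ is the order of the group element $a$. *)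

theory Defs
  imports "HOL-Algebra.Algebra" "HOL-Combinatorics.Permutations"
begin

text \<open>
  A sequence of length \<open>n\<close> is a function on \<open>nat\<close> of which only the values at the indices
  \<open>1, \<dots>, n\<close> matter; a subsequence is given by its index set, so repeated terms are kept apart.
  Abelian groups are written additively (locale \<^locale>\<open>abelian_group\<close>); the
  multiplicative components of the underlying ring record play no role.
\<close>

definition subseq_sums :: "('a, 'm) ring_scheme \<Rightarrow> (nat \<Rightarrow> 'a) \<Rightarrow> nat \<Rightarrow> 'a set" where
  "subseq_sums G \<alpha> n = {finsum G \<alpha> I | I. I \<subseteq> {1..n}}"

definition zero_sum_free :: "('a, 'm) ring_scheme \<Rightarrow> (nat \<Rightarrow> 'a) \<Rightarrow> nat \<Rightarrow> bool" where
  "zero_sum_free G \<alpha> n \<longleftrightarrow> (\<forall>I. I \<subseteq> {1..n} \<and> I \<noteq> {} \<longrightarrow> finsum G \<alpha> I \<noteq> \<zero>\<^bsub>G\<^esub>)"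

definition add_ord :: "('a, 'm) ring_scheme \<Rightarrow> 'a \<Rightarrow> nat" where
  "add_ord G a = group.ord (add_monoid G) a"

definition finite_add_ord :: "('a, 'm) ring_scheme \<Rightarrow> 'a \<Rightarrow> bool" where
  "finite_add_ord G a \<longleftrightarrow> (\<exists>m::nat. m > 0 \<and> [m] \<cdot>\<^bsub>G\<^esub> a = \<zero>\<^bsub>G\<^esub>)"

text \<open>\<^const>\<open>group.ord\<close> is \<open>0\<close> exactly on elements of infinite order.\<close>

lemma (in abelian_group) finite_add_ord_iff:
  assumes "a \<in> carrier G"
  shows "finite_add_ord G a \<longleftrightarrow> add_ord G a > 0"
proof -
  have eq: "([m] \<cdot> a = \<zero>) \<longleftrightarrow> add_ord G a dvd m" for m :: nat
    using group.pow_eq_id[OF a_group, of a m] assms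
    by (simp add: add_ord_def add_pow_def)
  show ?thesis
    unfolding finite_add_ord_def eq by (auto intro: dvd_pos_nat)
qed

end

theory Submission
  imports Defs
begin

text \<open>
  Write \<open>\<Sigma>(S)\<close> for the set of sums of subfamilies of the zero-sum-free family indexed by \<open>S\<close>, and
  \<open>\<sigma>\<close> for the sum of the whole family. Dropping an index \<open>g\<close> always loses the sum \<open>\<sigma>\<close>, because the
  complement of a subfamily with sum \<open>\<sigma>\<close> has sum zero. The argument separates the families in which
  some index costs at least two sums from those in which every index costs exactly one.

  In the first case, removing that index \<open>g\<close> preserves the hypothesis \<open>|\<Sigma>(S)| < 2|S|\<close>, so by
  induction the sums of the rest \<open>T\<close> are \<open>0, a, \<dots>, Ma\<close>. The two sets \<open>\<Sigma>(T)\<close> and \<open>\<alpha> g + \<Sigma>(T)\<close>, whose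
  union is \<open>\<Sigma>(S)\<close>, have more than \<open>|T|\<close> elements each, hence cannot be disjoint. A common element
  gives \<open>\<alpha> g = va\<close> with \<open>|v| \<le> M\<close>, and \<open>v \<ge> 1\<close> since otherwise \<open>-\<alpha> g\<close> would be a sum over \<open>T\<close>. Then
  \<open>\<Sigma>(S)\<close> is \<open>0, a, \<dots>, (M + v)a\<close> (\<open>progression_coords_insert\<close>).

  In the second case all terms are equal (\<open>all_equal_if_single_new_sums\<close>), and the conclusion holds
  with all coefficients equal to \<open>1\<close>. By complementation every nonzero sum \<open>x\<close> can be written as
  \<open>\<alpha> h + s\<close> with \<open>s\<close> a sum that avoids the index \<open>h\<close>, for each \<open>h\<close>. If \<open>\<alpha> g \<noteq> \<alpha> h\<close>, then starting
  from the sum \<open>\<alpha> g\<close> one may subtract first \<open>\<alpha> h\<close> and then \<open>\<alpha> g\<close>; this shows that \<open>-\<alpha> h\<close> is a sum,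
  and one that avoids \<open>h\<close>, contrary to zero-sum-freeness.

  The induction is carried out for families indexed by arbitrary finite sets, with a condition on
  the coefficients that does not mention any order; only the final proof sorts them.
\<close>

section \<open>Subset sums of an indexed family\<close>

definition subset_sums :: "('g, 'm) ring_scheme \<Rightarrow> ('i \<Rightarrow> 'g) \<Rightarrow> 'i set \<Rightarrow> 'g set" where
  "subset_sums G \<alpha> S = {finsum G \<alpha> I | I. I \<subseteq> S}"

definition zero_free_on :: "('g, 'm) ring_scheme \<Rightarrow> ('i \<Rightarrow> 'g) \<Rightarrow> 'i set \<Rightarrow> bool" where
  "zero_free_on G \<alpha> S \<longleftrightarrow> (\<forall>I. I \<subseteq> S \<and> I \<noteq> {} \<longrightarrow> finsum G \<alpha> I \<noteq> \<zero>\<^bsub>G\<^esub>)"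

lemma subset_sums_finite: "finite S \<Longrightarrow> finite (subset_sums G \<alpha> S)"
proof -
  assume "finite S"
  moreover have "subset_sums G \<alpha> S = finsum G \<alpha> ` Pow S"
    by (auto simp: subset_sums_def)
  ultimately show ?thesis by simp
qed

lemma subset_sumsI: "I \<subseteq> S \<Longrightarrow> finsum G \<alpha> I \<in> subset_sums G \<alpha> S"
  by (auto simp: subset_sums_def)

lemma subset_sums_mono: "T \<subseteq> S \<Longrightarrow> subset_sums G \<alpha> T \<subseteq> subset_sums G \<alpha> S"
  by (auto simp: subset_sums_def)

lemma zero_free_onD:
  "zero_free_on G \<alpha> S \<Longrightarrow> I \<subseteq> S \<Longrightarrow> I \<noteq> {} \<Longrightarrow> finsum G \<alpha> I \<noteq> \<zero>\<^bsub>G\<^esub>"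
  by (simp add: zero_free_on_def)

lemma zero_free_on_subset: "zero_free_on G \<alpha> S \<Longrightarrow> T \<subseteq> S \<Longrightarrow> zero_free_on G \<alpha> T"
  unfolding zero_free_on_def by blast

context abelian_group
begin

lemma int_multiple_closed: "a \<in> carrier G \<Longrightarrow> [(i::int)] \<cdot> a \<in> carrier G"
  using group.int_pow_closed[OF a_group, of a i] by (simp add: add_pow_def)

lemma int_multiple_zero: "[(0::int)] \<cdot> a = \<zero>"
  by (simp add: add_pow_def)

lemma int_multiple_one: "a \<in> carrier G \<Longrightarrow> [(1::int)] \<cdot> a = a"
  using group.int_pow_1[OF a_group, of a] by (simp add: add_pow_def)

lemma int_multiple_add:
  "a \<in> carrier G \<Longrightarrow> [(i::int)] \<cdot> a \<oplus> [(j::int)] \<cdot> a = [(i + j)] \<cdot> a"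
  using group.int_pow_mult[OF a_group, of a i j] by (simp add: add_pow_def)

lemma subset_sums_carrier:
  "\<alpha> \<in> S \<rightarrow> carrier G \<Longrightarrow> subset_sums G \<alpha> S \<subseteq> carrier G"
  by (auto simp: subset_sums_def intro!: finsum_closed)

lemma finsum_remove:
  assumes "finite I" "g \<in> I" "\<alpha> \<in> I \<rightarrow> carrier G"
  shows "finsum G \<alpha> I = \<alpha> g \<oplus> finsum G \<alpha> (I - {g})"
proof -
  have "finsum G \<alpha> (insert g (I - {g})) = \<alpha> g \<oplus> finsum G \<alpha> (I - {g})"
    using assms by (intro finsum_insert) auto
  then show ?thesis using assms(2) by (simp add: insert_absorb)
qed

lemma finsum_Diff:
  assumes "finite S" "I \<subseteq> S" "\<alpha> \<in> S \<rightarrow> carrier G"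
  shows "finsum G \<alpha> S = finsum G \<alpha> I \<oplus> finsum G \<alpha> (S - I)"
proof -
  have "finsum G \<alpha> (I \<union> (S - I)) = finsum G \<alpha> I \<oplus> finsum G \<alpha> (S - I)"
    using assms finite_subset[OF assms(2)] by (intro finsum_Un_disjoint) auto
  then show ?thesis using assms(2) by (simp add: Un_absorb1)
qed

lemma subset_sums_insert:
  assumes "finite T" "g \<notin> T" "\<alpha> \<in> insert g T \<rightarrow> carrier G"
  shows "subset_sums G \<alpha> (insert g T)
    = subset_sums G \<alpha> T \<union> (\<lambda>s. \<alpha> g \<oplus> s) ` subset_sums G \<alpha> T" (is "?l = ?r")
proof
  show "?l \<subseteq> ?r"
  proof
    fix s assume "s \<in> ?l"
    then obtain I where I: "I \<subseteq> insert g T" "s = finsum G \<alpha> I"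
      by (auto simp: subset_sums_def)
    show "s \<in> ?r"
    proof (cases "g \<in> I")
      case True
      have "finsum G \<alpha> I = \<alpha> g \<oplus> finsum G \<alpha> (I - {g})"
        using I True assms finite_subset[OF I(1)] by (intro finsum_remove) auto
      moreover have "finsum G \<alpha> (I - {g}) \<in> subset_sums G \<alpha> T"
        using I by (intro subset_sumsI) auto
      ultimately show ?thesis using I by blast
    next
      case False
      then show ?thesis using I by (auto intro: subset_sumsI)
    qed
  qed
  show "?r \<subseteq> ?l"
  proof -
    have "\<alpha> g \<oplus> finsum G \<alpha> I \<in> ?l" if "I \<subseteq> T" for I
    proof -
      have "finsum G \<alpha> (insert g I) = \<alpha> g \<oplus> finsum G \<alpha> I"
        using that assms finite_subset[OF that] by (intro finsum_insert) auto
      then show ?thesis using that subset_sumsI[of "insert g I" "insert g T" G \<alpha>] by auto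
    qed
    moreover have "subset_sums G \<alpha> T \<subseteq> ?l" by (intro subset_sums_mono) auto
    ultimately show ?thesis by (auto simp: subset_sums_def)
  qed
qed

text \<open>
  Zero-sum-freeness is used mostly in this form: a sum avoiding \<open>g\<close> is never \<open>-\<alpha> g\<close>. That the
  subfamily avoids \<open>g\<close> is essential, since otherwise adding \<open>\<alpha> g\<close> would use that term twice.
\<close>

lemma zero_free_on_no_negative:
  assumes "finite S" "\<alpha> \<in> S \<rightarrow> carrier G" "zero_free_on G \<alpha> S" "g \<in> S"
    and "s \<in> subset_sums G \<alpha> (S - {g})"
  shows "\<alpha> g \<oplus> s \<noteq> \<zero>"
proof -
  obtain I where I: "I \<subseteq> S - {g}" "s = finsum G \<alpha> I"
    using assms(5) by (auto simp: subset_sums_def)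
  have "finite I" using I(1) assms(1) by (meson finite_Diff finite_subset)
  then have "finsum G \<alpha> (insert g I) = \<alpha> g \<oplus> s"
    unfolding I(2) using I(1) assms(2,4) by (intro finsum_insert) auto
  moreover have "finsum G \<alpha> (insert g I) \<noteq> \<zero>"
    using I(1) assms(4) by (intro zero_free_onD[OF assms(3)]) auto
  ultimately show ?thesis by simp
qed

text \<open>
  If the total were the sum of a subfamily without \<open>g\<close>, the complement of that subfamily would
  contain \<open>g\<close> and have sum zero.
\<close>

lemma total_notin_subset_sums_remove:
  assumes "finite S" "\<alpha> \<in> S \<rightarrow> carrier G" "zero_free_on G \<alpha> S" "g \<in> S"
  shows "finsum G \<alpha> S \<notin> subset_sums G \<alpha> (S - {g})"
proof
  assume "finsum G \<alpha> S \<in> subset_sums G \<alpha> (S - {g})"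
  then obtain I where I: "I \<subseteq> S - {g}" "finsum G \<alpha> S = finsum G \<alpha> I"
    by (auto simp: subset_sums_def)
  have IS: "I \<subseteq> S" using I(1) by auto
  have cI: "finsum G \<alpha> I \<in> carrier G" and cD: "finsum G \<alpha> (S - I) \<in> carrier G"
    using I(1) assms(2) by (auto intro!: finsum_closed)
  have "finsum G \<alpha> I \<oplus> finsum G \<alpha> (S - I) = finsum G \<alpha> I \<oplus> \<zero>"
    using finsum_Diff[OF assms(1) IS assms(2)] I(2) cI by simp
  then have "finsum G \<alpha> (S - I) = \<zero>"
    using cI cD by simp
  moreover have "S - I \<subseteq> S" "S - I \<noteq> {}" using I(1) assms(4) by auto
  ultimately show False using zero_free_onD[OF assms(3)] by metis
qed

lemma card_subset_sums_remove:
  assumes "finite S" "\<alpha> \<in> S \<rightarrow> carrier G" "zero_free_on G \<alpha> S" "g \<in> S"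
  shows "card (subset_sums G \<alpha> (S - {g})) < card (subset_sums G \<alpha> S)"
proof (rule psubset_card_mono)
  show "finite (subset_sums G \<alpha> S)" using assms(1) by (rule subset_sums_finite)
  show "subset_sums G \<alpha> (S - {g}) \<subset> subset_sums G \<alpha> S"
    using total_notin_subset_sums_remove[OF assms] subset_sums_mono[of "S - {g}" S G \<alpha>]
      subset_sumsI[of S S G \<alpha>] by auto
qed

lemma card_less_card_subset_sums:
  assumes "finite S" "\<alpha> \<in> S \<rightarrow> carrier G" "zero_free_on G \<alpha> S"
  shows "card S < card (subset_sums G \<alpha> S)"
  using assms
proof (induction S rule: finite_induct)
  case empty
  then show ?case by (simp add: subset_sums_def)
next
  case (insert g T)
  have "card T < card (subset_sums G \<alpha> T)"
    using insert.prems by (intro insert.IH zero_free_on_subset[of G \<alpha> "insert g T" T]) auto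
  moreover have "card (subset_sums G \<alpha> T) < card (subset_sums G \<alpha> (insert g T))"
    using card_subset_sums_remove[of "insert g T" \<alpha> g] insert by auto
  ultimately show ?case using insert by simp
qed

section \<open>Families all of whose terms contribute a single new sum\<close>

text \<open>
  The map \<open>x \<mapsto> \<sigma> - x\<close> is an involution of the subset sums, induced by complementing index sets.
  If \<open>x \<noteq> \<zero>\<close>, then \<open>\<sigma> - x\<close> is not the total, the only sum lost without \<open>g\<close>, so it can be written without \<open>g\<close>; the
  complementary representation of \<open>x\<close> then contains \<open>g\<close>.
\<close>

lemma subtract_term_from_subset_sum:
  assumes fin: "finite S" and car: "\<alpha> \<in> S \<rightarrow> carrier G" and "g \<in> S"
    and one: "subset_sums G \<alpha> S \<subseteq> insert (finsum G \<alpha> S) (subset_sums G \<alpha> (S - {g}))"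
    and x: "x \<in> subset_sums G \<alpha> S" "x \<noteq> \<zero>"
  obtains s where "s \<in> subset_sums G \<alpha> (S - {g})" "x = \<alpha> g \<oplus> s"
proof -
  obtain I where I: "I \<subseteq> S" "x = finsum G \<alpha> I"
    using x(1) by (auto simp: subset_sums_def)
  have cS: "finsum G \<alpha> J \<in> carrier G" if "J \<subseteq> S" for J
    using that car by (auto intro!: finsum_closed)
  have split: "finsum G \<alpha> S = x \<oplus> finsum G \<alpha> (S - I)"
    unfolding I(2) using fin I(1) car by (rule finsum_Diff)
  have xc: "x \<in> carrier G" using cS[OF I(1)] I(2) by simp
  have Dc: "finsum G \<alpha> (S - I) \<in> carrier G" by (rule cS) auto
  have "finsum G \<alpha> (S - I) \<noteq> finsum G \<alpha> S"
  proof
    assume "finsum G \<alpha> (S - I) = finsum G \<alpha> S"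
    then have "x \<oplus> finsum G \<alpha> (S - I) = \<zero> \<oplus> finsum G \<alpha> (S - I)"
      using split Dc by simp
    then show False using x(2) xc Dc by simp
  qed
  moreover have "finsum G \<alpha> (S - I) \<in> subset_sums G \<alpha> S"
    by (intro subset_sumsI) auto
  ultimately have "finsum G \<alpha> (S - I) \<in> subset_sums G \<alpha> (S - {g})"
    using one by auto
  then obtain J where J: "J \<subseteq> S - {g}" "finsum G \<alpha> (S - I) = finsum G \<alpha> J"
    by (auto simp: subset_sums_def)
  have JS: "J \<subseteq> S" using J(1) by auto
  have "x \<oplus> finsum G \<alpha> J = finsum G \<alpha> J \<oplus> finsum G \<alpha> (S - J)"
    using split finsum_Diff[OF fin JS car] J(2) by simp
  also have "\<dots> = finsum G \<alpha> (S - J) \<oplus> finsum G \<alpha> J"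
    using cS[OF JS] cS[of "S - J"] by (intro a_comm) auto
  finally have "x = finsum G \<alpha> (S - J)"
    using xc cS[OF JS] cS[of "S - J"] by simp
  also have "\<dots> = \<alpha> g \<oplus> finsum G \<alpha> (S - J - {g})"
    using J(1) \<open>g \<in> S\<close> fin car by (intro finsum_remove) auto
  finally show ?thesis
    by (rule that[rotated]) (auto intro: subset_sumsI)
qed

text \<open>
  If \<open>\<alpha> g \<noteq> \<alpha> h\<close>, two applications of the previous lemma lead from \<open>\<alpha> g\<close> to \<open>s = \<alpha> g - \<alpha> h\<close> and from
  there to \<open>t = -\<alpha> h\<close>. The second one only yields a representation of \<open>t\<close> that avoids \<open>g\<close>; since
  such a \<open>t\<close> differs from the total, and the total is the only sum lost by dropping an index, \<open>t\<close>
  also has a representation that avoids \<open>h\<close>, which is impossible.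
\<close>

lemma all_equal_if_single_new_sums:
  assumes fin: "finite S" and car: "\<alpha> \<in> S \<rightarrow> carrier G" and zf: "zero_free_on G \<alpha> S"
    and one: "\<And>g. g \<in> S \<Longrightarrow>
      card (subset_sums G \<alpha> S) \<le> Suc (card (subset_sums G \<alpha> (S - {g})))"
    and gh: "g \<in> S" "h \<in> S"
  shows "\<alpha> g = \<alpha> h"
proof (rule ccontr)
  assume ne: "\<alpha> g \<noteq> \<alpha> h"
  have new: "subset_sums G \<alpha> S \<subseteq> insert (finsum G \<alpha> S) (subset_sums G \<alpha> (S - {k}))"
    if "k \<in> S" for k
  proof -
    let ?B = "insert (finsum G \<alpha> S) (subset_sums G \<alpha> (S - {k}))"
    have "?B \<subseteq> subset_sums G \<alpha> S"
      using subset_sums_mono[of "S - {k}" S G \<alpha>] subset_sumsI[of S S G \<alpha>] by auto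
    moreover have "card (subset_sums G \<alpha> S) \<le> card ?B"
      using one[OF that] total_notin_subset_sums_remove[OF fin car zf that] fin
      by (simp add: subset_sums_finite)
    ultimately have "?B = subset_sums G \<alpha> S"
      using fin by (intro card_seteq subset_sums_finite)
    then show ?thesis by simp
  qed
  have gc: "\<alpha> g \<in> carrier G" and hc: "\<alpha> h \<in> carrier G" using car gh by auto
  have single: "\<alpha> g \<in> subset_sums G \<alpha> S"
    using subset_sumsI[of "{g}" S G \<alpha>] gh gc finsum_insert[of "{}" g \<alpha>] by simp
  have "\<alpha> g \<noteq> \<zero>"
    using zero_free_on_no_negative[OF fin car zf gh(1), of \<zero>] gc
      subset_sumsI[of "{}" "S - {g}" G \<alpha>] by auto
  then obtain s where s: "s \<in> subset_sums G \<alpha> (S - {h})" "\<alpha> g = \<alpha> h \<oplus> s"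
    using subtract_term_from_subset_sum[OF fin car gh(2) new[OF gh(2)] single] by blast
  have s': "s \<in> subset_sums G \<alpha> S" using s(1) subset_sums_mono[of "S - {h}" S G \<alpha>] by auto
  have sc: "s \<in> carrier G" using s' subset_sums_carrier[OF car] by auto
  have "s \<noteq> \<zero>" using s(2) ne hc by auto
  then obtain t where t: "t \<in> subset_sums G \<alpha> (S - {g})" "s = \<alpha> g \<oplus> t"
    using subtract_term_from_subset_sum[OF fin car gh(1) new[OF gh(1)] s'] by blast
  have tc: "t \<in> carrier G"
    using t(1) subset_sums_mono[of "S - {g}" S G \<alpha>] subset_sums_carrier[OF car] by auto
  have "\<alpha> g \<oplus> (\<alpha> h \<oplus> t) = \<alpha> h \<oplus> s"
    unfolding t(2) using gc hc tc by (rule a_lcomm)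
  also have "\<dots> = \<alpha> g \<oplus> \<zero>" using s(2) gc by simp
  finally have "\<alpha> g \<oplus> (\<alpha> h \<oplus> t) = \<alpha> g \<oplus> \<zero>" .
  then have ht: "\<alpha> h \<oplus> t = \<zero>" using gc hc tc by simp
  have "t \<in> subset_sums G \<alpha> S"
    using t(1) subset_sums_mono[of "S - {g}" S G \<alpha>] by auto
  moreover have "t \<noteq> finsum G \<alpha> S"
    using total_notin_subset_sums_remove[OF fin car zf gh(1)] t(1) by auto
  ultimately have "t \<in> subset_sums G \<alpha> (S - {h})" using new[OF gh(2)] by auto
  then show False using zero_free_on_no_negative[OF fin car zf gh(2), of t] ht by simp
qed

end

section \<open>Families whose sums form a progression\<close>

text \<open>
  The fourth conjunct is the condition \<open>x\<^sub>k\<^sub>+\<^sub>1 \<le> x\<^sub>1 + \<dots> + x\<^sub>k\<close> on the increasingly sorted coefficients,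
  freed from the sorting so that a term may be inserted at any place. Applied to the \<open>k\<close> smallest
  coefficients, it bounds one of the others and hence the next smallest one. Conversely, for any \<open>L\<close>
  the smallest coefficient outside \<open>L\<close> is \<open>1\<close> or at most the sum of its predecessors, all of which
  belong to \<open>L\<close>. The last conjunct says that \<open>sum y S\<close> is less than the order of \<open>a\<close>, in a form that
  also makes sense for infinite order.
\<close>

definition progression_coords ::
    "('g, 'm) ring_scheme \<Rightarrow> ('i \<Rightarrow> 'g) \<Rightarrow> 'i set \<Rightarrow> 'g \<Rightarrow> ('i \<Rightarrow> int) \<Rightarrow> bool" where
  "progression_coords G \<alpha> S a y \<longleftrightarrow>
    a \<in> carrier G \<and>
    (\<forall>i\<in>S. 1 \<le> y i \<and> \<alpha> i = [y i] \<cdot>\<^bsub>G\<^esub> a) \<and>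
    (\<exists>i\<in>S. y i = 1) \<and>
    (\<forall>L. L \<subset> S \<and> L \<noteq> {} \<longrightarrow> (\<exists>i\<in>S - L. y i \<le> sum y L)) \<and>
    subset_sums G \<alpha> S = (\<lambda>j. [j] \<cdot>\<^bsub>G\<^esub> a) ` {0..sum y S} \<and>
    (\<forall>j. 0 < j \<and> j \<le> sum y S \<longrightarrow> [j] \<cdot>\<^bsub>G\<^esub> a \<noteq> \<zero>\<^bsub>G\<^esub>)"

context abelian_group
begin

text \<open>
  The bound \<open>v \<le> sum y T\<close> makes the two progressions \<open>0, \<dots>, M\<close> and \<open>v, \<dots>, M + v\<close> overlap, where
  \<open>M = sum y T\<close>. The longer progression still avoids zero: if \<open>M < j \<le> M + v\<close>, then \<open>(j - v) a\<close> is a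
  sum over \<open>T\<close> and therefore not the negative of \<open>\<alpha> g = v a\<close>.
\<close>

lemma progression_coords_insert:
  assumes fin: "finite T" and g: "g \<notin> T" and car: "\<alpha> \<in> insert g T \<rightarrow> carrier G"
    and zf: "zero_free_on G \<alpha> (insert g T)"
    and T: "progression_coords G \<alpha> T a y"
    and v: "1 \<le> v" "v \<le> sum y T" and ag: "\<alpha> g = [v] \<cdot> a"
  shows "progression_coords G \<alpha> (insert g T) a (y(g := v))"
proof -
  define y' where "y' = y(g := v)"
  define M where "M = sum y T"
  have ac: "a \<in> carrier G"
    and coords: "\<And>i. i \<in> T \<Longrightarrow> 1 \<le> y i \<and> \<alpha> i = [y i] \<cdot> a"
    and ex1: "\<exists>i\<in>T. y i = 1"
    and gap: "\<And>L. L \<subset> T \<Longrightarrow> L \<noteq> {} \<Longrightarrow> \<exists>i\<in>T - L. y i \<le> sum y L"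
    and sums: "subset_sums G \<alpha> T = (\<lambda>j. [j] \<cdot> a) ` {0..M}"
    and nz: "\<And>j. 0 < j \<Longrightarrow> j \<le> M \<Longrightarrow> [j] \<cdot> a \<noteq> \<zero>"
    using T unfolding progression_coords_def M_def by auto
  have y'T: "y' i = y i" if "i \<in> T" for i using that g by (auto simp: y'_def)
  have y'g: "y' g = v" by (simp add: y'_def)
  have sum': "sum y' L = sum y L" if "L \<subseteq> T" for L
    using that by (intro sum.cong) (auto simp: y'T)
  have sumS: "sum y' (insert g T) = M + v"
    using fin g sum'[of T] by (simp add: y'g M_def)
  have gap': "\<exists>i\<in>insert g T - L. y' i \<le> sum y' L" if L: "L \<subset> insert g T" "L \<noteq> {}" for L
  proof (cases "g \<in> L")
    case True
    define K where "K = L - {g}"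
    have K: "K \<subset> T" "L = insert g K" "g \<notin> K" "finite K"
      using True L fin g finite_subset[of K T] by (auto simp: K_def)
    have sumL: "sum y' L = v + sum y K"
      using K sum'[of K] by (auto simp: y'g)
    show ?thesis
    proof (cases "K = {}")
      case True
      obtain i where "i \<in> T" "y i = 1" using ex1 by auto
      then show ?thesis using True K g v sumL y'T[of i] by (intro bexI[of _ i]) auto
    next
      case False
      then obtain i where i: "i \<in> T - K" "y i \<le> sum y K" using gap K(1) by blast
      then show ?thesis using K g v sumL y'T[of i] by (intro bexI[of _ i]) auto
    qed
  next
    case False
    then have LT: "L \<subseteq> T" using L by auto
    show ?thesis
    proof (cases "L = T")
      case True
      then show ?thesis using g v sum'[of T] by (intro bexI[of _ g]) (auto simp: y'g)
    next
      case False
      then obtain i where "i \<in> T - L" "y i \<le> sum y L" using gap LT L(2) by blast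
      then show ?thesis using g y'T[of i] sum'[OF LT] by (intro bexI[of _ i]) auto
    qed
  qed
  have sums': "subset_sums G \<alpha> (insert g T) = (\<lambda>j. [j] \<cdot> a) ` {0..M + v}"
  proof -
    have "(\<lambda>s. \<alpha> g \<oplus> s) ` subset_sums G \<alpha> T = (\<lambda>j. [j] \<cdot> a) ` ((\<lambda>j. v + j) ` {0..M})"
      unfolding sums image_image ag by (intro image_cong refl int_multiple_add ac)
    also have "(\<lambda>j. v + j) ` {0..M} = {v..M + v}" by (simp add: add.commute)
    finally have "subset_sums G \<alpha> (insert g T) = (\<lambda>j. [j] \<cdot> a) ` ({0..M} \<union> {v..M + v})"
      using subset_sums_insert[OF fin g car] sums by (simp add: image_Un)
    also have "{0..M} \<union> {v..M + v} = {0..M + v}" using v by (auto simp: M_def)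
    finally show ?thesis .
  qed
  have nz': "[j] \<cdot> a \<noteq> \<zero>" if j: "0 < j" "j \<le> M + v" for j
  proof (cases "j \<le> M")
    case True
    then show ?thesis using nz j by blast
  next
    case False
    then have "[(j - v)] \<cdot> a \<in> subset_sums G \<alpha> T"
      unfolding sums using j v by (intro imageI) (auto simp: M_def)
    then have "\<alpha> g \<oplus> [(j - v)] \<cdot> a \<noteq> \<zero>"
      using zero_free_on_no_negative[OF _ car zf, of g] fin g by simp
    then show ?thesis using int_multiple_add[OF ac, of v "j - v"] ag by simp
  qed
  have "\<forall>i\<in>insert g T. 1 \<le> y' i \<and> \<alpha> i = [y' i] \<cdot> a"
    using coords y'T y'g v(1) ag by simp
  moreover have "\<exists>i\<in>insert g T. y' i = 1"
    using ex1 y'T by force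
  ultimately have "progression_coords G \<alpha> (insert g T) a y'"
    unfolding progression_coords_def sumS using ac gap' sums' nz' by blast
  then show ?thesis by (simp only: y'_def)
qed

lemma progression_coords_constant:
  assumes "finite S" "S \<noteq> {}" "a \<in> carrier G"
    and "\<And>i. i \<in> S \<Longrightarrow> \<alpha> i = a" "zero_free_on G \<alpha> S"
  shows "\<exists>y. progression_coords G \<alpha> S a y"
  using assms
proof (induction S rule: finite_ne_induct)
  case (singleton g)
  have ag: "\<alpha> g = a" and ac: "a \<in> carrier G" and zf: "zero_free_on G \<alpha> {g}"
    using singleton by auto
  have car: "\<alpha> \<in> {g} \<rightarrow> carrier G" using ag ac by simp
  have empty: "subset_sums G \<alpha> {} = {\<zero>}" by (simp add: subset_sums_def)
  have "a \<noteq> \<zero>"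
    using zero_free_on_no_negative[OF _ car zf, of g \<zero>] empty ag ac by simp
  then have nz: "[j] \<cdot> a \<noteq> \<zero>" if "0 < j" "j \<le> 1" for j :: int
    using that int_multiple_one[OF ac] by (cases "j = 1") auto
  have "{0..1::int} = {0, 1}" by auto
  then have "subset_sums G \<alpha> {g} = (\<lambda>j::int. [j] \<cdot> a) ` {0..1}"
    using subset_sums_insert[OF _ _ car] empty ag ac
    by (auto simp: int_multiple_zero int_multiple_one)
  moreover have "L = {}" if "L \<subset> {g}" for L using that by auto
  ultimately have "progression_coords G \<alpha> {g} a (\<lambda>_. 1)"
    unfolding progression_coords_def using nz ac ag int_multiple_one[OF ac] by auto
  then show ?case by blast
next
  case (insert g T)
  have "zero_free_on G \<alpha> T"
    using insert.prems(3) by (rule zero_free_on_subset) auto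
  then obtain y where y: "progression_coords G \<alpha> T a y"
    using insert.IH insert.prems by blast
  then have "\<exists>i\<in>T. y i = 1" and pos: "\<forall>i\<in>T. 1 \<le> y i"
    by (simp_all add: progression_coords_def)
  then obtain i where i: "i \<in> T" "y i = 1" by blast
  have "y i \<le> sum y T"
  proof (rule member_le_sum)
    show "0 \<le> y k" if "k \<in> T - {i}" for k
      using bspec[OF pos, of k] that by simp
  qed (use i(1) insert.hyps(1) in simp_all)
  then have "1 \<le> sum y T" using i(2) by simp
  moreover have "\<alpha> g = [(1::int)] \<cdot> a"
    using insert.prems by (simp add: int_multiple_one)
  moreover have "\<alpha> \<in> insert g T \<rightarrow> carrier G" using insert.prems(1,2) by blast
  ultimately have "progression_coords G \<alpha> (insert g T) a (y(g := 1))"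
    using insert.hyps(1,3) insert.prems(3) y by (intro progression_coords_insert) simp_all
  then show ?case by blast
qed

text \<open>
  The induction removes a term that contributes at least two new sums, because then the bound
  \<open>card (subset_sums G \<alpha> S) < 2 * card S\<close> passes to the remaining family. If no such term exists, all
  terms are equal.
\<close>

lemma small_subset_sums_progression:
  assumes "finite S" "\<alpha> \<in> S \<rightarrow> carrier G" "zero_free_on G \<alpha> S"
    and "card (subset_sums G \<alpha> S) < 2 * card S"
  shows "\<exists>a y. progression_coords G \<alpha> S a y"
  using assms
proof (induction S rule: finite_psubset_induct)
  case (psubset S)
  note fin = psubset.hyps and car = psubset.prems(1) and zf = psubset.prems(2)
    and small = psubset.prems(3)
  show ?case
  proof (cases "\<forall>g\<in>S. card (subset_sums G \<alpha> S) \<le> Suc (card (subset_sums G \<alpha> (S - {g})))")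
    case True
    have "S \<noteq> {}" using small by auto
    then obtain g where g: "g \<in> S" by auto
    have eq: "\<alpha> i = \<alpha> g" if "i \<in> S" for i
      by (rule all_equal_if_single_new_sums[OF fin car zf _ that g]) (rule bspec[OF True])
    have "\<alpha> g \<in> carrier G" using car g by auto
    then have "\<exists>y. progression_coords G \<alpha> S (\<alpha> g) y"
      using eq by (rule progression_coords_constant[OF fin \<open>S \<noteq> {}\<close> _ _ zf])
    then show ?thesis ..
  next
    case False
    then obtain g where g: "g \<in> S"
      and two: "card (subset_sums G \<alpha> (S - {g})) + 2 \<le> card (subset_sums G \<alpha> S)"
      by force
    define T where "T = S - {g}"
    have S: "S = insert g T" "g \<notin> T" "finite T" "T \<subset> S" "card S = Suc (card T)"
      using g fin card.remove[OF fin g] by (auto simp: T_def)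
    have carT: "\<alpha> \<in> T \<rightarrow> carrier G" using car S by auto
    have zfT: "zero_free_on G \<alpha> T" using zf S by (auto intro: zero_free_on_subset)
    have "card (subset_sums G \<alpha> T) < 2 * card T"
      using two small S(5) by (simp add: T_def)
    then obtain a y where T: "progression_coords G \<alpha> T a y"
      using psubset.IH[OF S(4) carT zfT] by auto
    then have ac: "a \<in> carrier G"
      and sums: "subset_sums G \<alpha> T = (\<lambda>j. [j] \<cdot> a) ` {0..sum y T}"
      by (auto simp: progression_coords_def)
    have gc: "\<alpha> g \<in> carrier G" using car g by auto
    define A where "A = subset_sums G \<alpha> T"
    have finA: "finite A" using S(3) by (simp add: A_def subset_sums_finite)
    have Ac: "A \<subseteq> carrier G" using subset_sums_carrier[OF carT] by (simp add: A_def)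
    \<comment> \<open>Otherwise there would be \<open>2 * card A \<ge> 2 * (card T + 1)\<close> sums.\<close>
    have "A \<inter> (\<lambda>s. \<alpha> g \<oplus> s) ` A \<noteq> {}"
    proof
      assume disj: "A \<inter> (\<lambda>s. \<alpha> g \<oplus> s) ` A = {}"
      have "card (subset_sums G \<alpha> S) = card A + card ((\<lambda>s. \<alpha> g \<oplus> s) ` A)"
        using subset_sums_insert[of T g \<alpha>] S car finA disj
        by (simp add: card_Un_disjoint A_def)
      also have "card ((\<lambda>s. \<alpha> g \<oplus> s) ` A) = card A"
        using Ac gc by (intro card_image inj_onI) (auto simp: subset_iff)
      finally show False
        using card_less_card_subset_sums[OF S(3) carT zfT] small S(5) by (simp add: A_def)
    qed
    then obtain s where s: "s \<in> A" "\<alpha> g \<oplus> s \<in> A" by blast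
    from s(1) obtain i where i: "i \<in> {0..sum y T}" "s = [i] \<cdot> a"
      unfolding A_def sums by (rule imageE)
    from s(2) obtain j where j: "j \<in> {0..sum y T}" "\<alpha> g \<oplus> s = [j] \<cdot> a"
      unfolding A_def sums by (rule imageE)
    have ij: "i \<in> {0..sum y T}" "j \<in> {0..sum y T}" "[j] \<cdot> a = \<alpha> g \<oplus> [i] \<cdot> a"
      using i j by simp_all
    have "\<alpha> g \<oplus> [i] \<cdot> a = [(j - i)] \<cdot> a \<oplus> [i] \<cdot> a"
      using ij(3) int_multiple_add[OF ac, of "j - i" i] by simp
    then have ag: "\<alpha> g = [(j - i)] \<cdot> a"
      using gc ac by (simp add: int_multiple_closed)
    \<comment> \<open>If \<open>j \<le> i\<close>, then \<open>-\<alpha> g = (i - j) a\<close> lies in the progression of sums over \<open>T\<close>.\<close>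
    have "1 \<le> j - i"
    proof (rule ccontr)
      assume "\<not> 1 \<le> j - i"
      then have "[(i - j)] \<cdot> a \<in> subset_sums G \<alpha> (S - {g})"
        unfolding T_def[symmetric] sums using ij by (intro imageI) auto
      then have "\<alpha> g \<oplus> [(i - j)] \<cdot> a \<noteq> \<zero>"
        by (rule zero_free_on_no_negative[OF fin car zf g])
      then show False
        using int_multiple_add[OF ac, of "j - i" "i - j"] ag by (simp add: int_multiple_zero)
    qed
    moreover have "j - i \<le> sum y T" using ij by auto
    ultimately have "progression_coords G \<alpha> S a (y(g := j - i))"
      unfolding S(1) using S car zf ag T by (intro progression_coords_insert) auto
    then show ?thesis by blast
  qed
qed

end

section \<open>Sorting the coefficients\<close>

lemma sorting_permutation:
  fixes y :: "nat \<Rightarrow> 'b::linorder"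
  obtains \<pi> where "\<pi> permutes {1..n}"
    and "\<And>k l. 1 \<le> k \<Longrightarrow> k \<le> l \<Longrightarrow> l \<le> n \<Longrightarrow> y (\<pi> k) \<le> y (\<pi> l)"
proof -
  define xs where "xs = sort_key y [1..<Suc n]"
  have xs: "distinct xs" "set xs = {1..n}" "length xs = n" "sorted (map y xs)"
    by (auto simp: xs_def)
  define \<pi> where "\<pi> k = (if k \<in> {1..n} then xs ! (k - 1) else k)" for k
  have "bij_betw ((!) xs) {..<n} {1..n}"
    using xs bij_betw_nth[of xs] by blast
  moreover have "bij_betw (\<lambda>k. k - 1) {1..n} {..<n}"
    by (rule bij_betw_byWitness[where f' = Suc]) auto
  ultimately have "bij_betw ((!) xs \<circ> (\<lambda>k. k - 1)) {1..n} {1..n}"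
    by (rule bij_betw_trans[rotated])
  then have "bij_betw \<pi> {1..n} {1..n}"
    by (rule bij_betw_cong[THEN iffD1, rotated]) (simp add: \<pi>_def)
  then have "\<pi> permutes {1..n}"
    by (rule bij_imp_permutes) (auto simp: \<pi>_def)
  moreover have "y (\<pi> k) \<le> y (\<pi> l)" if "1 \<le> k" "k \<le> l" "l \<le> n" for k l
    using sorted_nth_mono[OF xs(4), of "k - 1" "l - 1"] that xs(3) by (simp add: \<pi>_def)
  ultimately show ?thesis by (rule that)
qed

theorem theorem2:
  fixes G :: "('g, 'm) ring_scheme" (structure)
    and n :: nat
    and \<alpha> :: "nat \<Rightarrow> 'g"
  assumes "abelian_group G"
    and "\<alpha> \<in> {1..n} \<rightarrow> carrier G"
    and "zero_sum_free G \<alpha> n"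
    and "card (subseq_sums G \<alpha> n) < 2 * n"
  shows "\<exists>\<pi> a (x :: nat \<Rightarrow> int).
    \<pi> permutes {1..n} \<and>
    a \<in> carrier G \<and>
    x 1 = 1 \<and>
    (\<forall>k\<in>{1..<n}. x k \<le> x (k + 1)) \<and>
    (\<forall>k\<in>{1..<n}. x (k + 1) \<le> (\<Sum>i=1..k. x i)) \<and>
    (\<forall>k\<in>{1..n}. \<alpha> (\<pi> k) = [x k] \<cdot> a) \<and>
    subseq_sums G \<alpha> n = (\<lambda>j::int. [j] \<cdot> a) ` {0..(\<Sum>i=1..n. x i)} \<and>
    (finite_add_ord G a \<longrightarrow> (\<Sum>i=1..n. x i) < int (add_ord G a))"
proof -
  interpret abelian_group G by fact
  have eq: "subseq_sums G \<alpha> n = subset_sums G \<alpha> {1..n}"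
    by (simp add: subseq_sums_def subset_sums_def)
  have zf: "zero_free_on G \<alpha> {1..n}"
    using assms(3) by (simp add: zero_sum_free_def zero_free_on_def)
  obtain a y where ay: "progression_coords G \<alpha> {1..n} a y"
    using small_subset_sums_progression[OF _ assms(2) zf] assms(4) eq by auto
  then have ac: "a \<in> carrier G"
    and coords: "\<And>i. i \<in> {1..n} \<Longrightarrow> 1 \<le> y i \<and> \<alpha> i = [y i] \<cdot> a"
    and ex1: "\<exists>i\<in>{1..n}. y i = 1"
    and gap: "\<And>L. L \<subset> {1..n} \<Longrightarrow> L \<noteq> {} \<Longrightarrow> \<exists>i\<in>{1..n} - L. y i \<le> sum y L"
    and sums: "subset_sums G \<alpha> {1..n} = (\<lambda>j. [j] \<cdot> a) ` {0..sum y {1..n}}"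
    and nz: "\<And>j. 0 < j \<Longrightarrow> j \<le> sum y {1..n} \<Longrightarrow> [j] \<cdot> a \<noteq> \<zero>"
    unfolding progression_coords_def by auto
  obtain \<pi> where \<pi>: "\<pi> permutes {1..n}"
    and mono: "\<And>k l. 1 \<le> k \<Longrightarrow> k \<le> l \<Longrightarrow> l \<le> n \<Longrightarrow> y (\<pi> k) \<le> y (\<pi> l)"
    using sorting_permutation[of n y] by blast
  define x where "x k = y (\<pi> k)" for k
  have inj: "inj \<pi>" using \<pi> by (rule permutes_inj)
  have img: "\<pi> ` {1..n} = {1..n}" using \<pi> by (rule permutes_image)
  have sum_x: "(\<Sum>i=1..k. x i) = sum y (\<pi> ` {1..k})" for k
    by (simp add: sum.reindex[OF inj_on_subset[OF inj subset_UNIV]] x_def comp_def)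
  have "x 1 = 1"
  proof -
    obtain i where i: "i \<in> {1..n}" "y i = 1" using ex1 by blast
    then have "i \<in> \<pi> ` {1..n}" using img by simp
    then obtain m where "i = \<pi> m" and m1: "m \<in> {1..n}" by (rule imageE)
    then have m: "m \<in> {1..n}" "y (\<pi> m) = 1" using i by simp_all
    then have "x 1 \<le> 1" using mono[of 1 m] by (simp add: x_def)
    moreover have "\<pi> 1 \<in> {1..n}"
      using m(1) permutes_in_image[OF \<pi>, of 1] by simp
    then have "1 \<le> x 1" using coords by (simp add: x_def)
    ultimately show ?thesis by simp
  qed
  \<comment> \<open>The condition on coefficients, applied to the \<open>k\<close> smallest ones, bounds some \<open>x m\<close> with
    \<open>m > k\<close>, and \<open>x (k + 1)\<close> is the smallest of these.\<close>
  moreover have "x (k + 1) \<le> (\<Sum>i=1..k. x i)" if k: "k \<in> {1..<n}" for k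
  proof -
    have "n \<in> {1..n}" "n \<notin> {1..k}" "{1..k} \<subseteq> {1..n}" using k by auto
    then have "\<pi> n \<in> {1..n}" "\<pi> n \<notin> \<pi> ` {1..k}" "\<pi> ` {1..k} \<subseteq> {1..n}"
      using permutes_in_image[OF \<pi>, of n] image_mono[of "{1..k}" "{1..n}" \<pi>] img
      by (simp_all add: inj_image_mem_iff[OF inj])
    then have "\<pi> ` {1..k} \<subset> {1..n}" by blast
    moreover have "\<pi> ` {1..k} \<noteq> {}" using k by auto
    ultimately have "\<exists>i\<in>{1..n} - \<pi> ` {1..k}. y i \<le> (\<Sum>i=1..k. x i)"
      unfolding sum_x by (rule gap)
    then obtain i where i: "i \<in> {1..n} - \<pi> ` {1..k}" "y i \<le> (\<Sum>i=1..k. x i)" by blast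
    then have "i \<in> \<pi> ` {1..n}" using img by simp
    then obtain m where "i = \<pi> m" and m: "m \<in> {1..n}" by (rule imageE)
    moreover have "m \<notin> {1..k}" using i(1) \<open>i = \<pi> m\<close> by auto
    ultimately show ?thesis using mono[of "k + 1" m] i(2) by (auto simp: x_def)
  qed
  moreover have "(\<Sum>i=1..n. x i) < int (add_ord G a)" if fin: "finite_add_ord G a"
  proof (rule ccontr)
    assume "\<not> (\<Sum>i=1..n. x i) < int (add_ord G a)"
    then have "int (add_ord G a) \<le> sum y {1..n}" using sum_x[of n] img by simp
    moreover have "0 < add_ord G a" using fin finite_add_ord_iff[OF ac] by simp
    ultimately have "[int (add_ord G a)] \<cdot> a \<noteq> \<zero>" by (intro nz) auto
    moreover have "[int (add_ord G a)] \<cdot> a = \<zero>"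
      using group.pow_ord_eq_1[OF a_group, of a] ac
      by (simp add: add_pow_def add_ord_def int_pow_int)
    ultimately show False by simp
  qed
  moreover have "\<alpha> (\<pi> k) = [x k] \<cdot> a" if "k \<in> {1..n}" for k
    using coords[of "\<pi> k"] that permutes_in_image[OF \<pi>, of k] by (simp add: x_def)
  moreover have "subseq_sums G \<alpha> n = (\<lambda>j. [j] \<cdot> a) ` {0..(\<Sum>i=1..n. x i)}"
    unfolding eq sums sum_x img ..
  moreover have "x k \<le> x (k + 1)" if "k \<in> {1..<n}" for k
    using mono[of k "k + 1"] that by (simp add: x_def)
  ultimately show ?thesis
    using \<pi> ac by (intro exI[of _ \<pi>] exI[of _ a] exI[of _ x] conjI ballI impI)
qed

end
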